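(* Let $B_c\in\mathbb C^{d,d}$ be such that all eigenvalues of $-B_c$ have negative real part, and let $\mu<0$ be the spectral abscissa of $-B_c$, i.e. the largest real part of an eigenvalue of $-B_c$. (i) If every eigenvalue of $-B_c$ with real part $\mu$ is semi-simple, then there exists $X>0$ such that $$XB_c+B_c^*X\ge-2\mu X,$$ and the inequality is not strict, i.e., there exists a nonzero vector $z\in\mathbb C^d$ such that $z^*(XB_c+B_c^*X+2\mu X)z=0$. (ii) If at least one eigenvalue $\lambda$ of $-B_c$ with real part $\mu$ is defective, i.e., there exists a Jordan block of size larger than one associated with $\lambda$, then for every $\epsilon>0$ there exists $X>0$ such that $$XB_c+B_c^*X\ge-2(\mu+\epsilon)X.$$
   Context: $\mathbb C^{d,d}$ denotes complex $d\times d$ matrices ($d\ge1$), $^*$ the conjugate transpose. $X>0$ means $X=X^*$ is Hermitian positive definite; $\ge$ between Hermitian matrices is the Loewner order (the difference is positive semidefinite). An eigenvalue is semi-simple if all its Jordan blocks have size one. *)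

theory Defs
  imports
    "Jordan_Normal_Form.Spectral_Radius"
    "Jordan_Normal_Form.Schur_Decomposition"
    "Jordan_Normal_Form.Jordan_Normal_Form_Existence"
    "Jordan_Normal_Form.Jordan_Normal_Form_Uniqueness"
begin

(* The maximum of an empty set is unspecified, so this is meaningful for square
   matrices of dimension at least one only. *)
definition spectral_abscissa :: "complex mat \<Rightarrow> real" where
  "spectral_abscissa A = Max (Re ` spectrum A)"

definition hermitian_mat :: "complex mat \<Rightarrow> bool" where
  "hermitian_mat A \<longleftrightarrow> mat_adjoint A = A"

(* (A *\<^sub>v z) \<bullet>c z is the sum of (A z)_i * cnj z_i, that is, z^* A z. It is real for
   Hermitian A; in the order on complex numbers used here, 0 < w and 0 \<le> w both entail
   that w is real. *)
definition pos_def_mat :: "complex mat \<Rightarrow> bool" where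
  "pos_def_mat A \<longleftrightarrow> hermitian_mat A \<and>
     (\<forall>z \<in> carrier_vec (dim_row A). z \<noteq> 0\<^sub>v (dim_row A) \<longrightarrow> 0 < (A *\<^sub>v z) \<bullet>c z)"

definition pos_semidef_mat :: "complex mat \<Rightarrow> bool" where
  "pos_semidef_mat A \<longleftrightarrow> hermitian_mat A \<and>
     (\<forall>z \<in> carrier_vec (dim_row A). 0 \<le> (A *\<^sub>v z) \<bullet>c z)"

definition loewner_le :: "complex mat \<Rightarrow> complex mat \<Rightarrow> bool" where
  "loewner_le A B \<longleftrightarrow> hermitian_mat A \<and> hermitian_mat B \<and> dim_row A = dim_row B \<and>
     pos_semidef_mat (B - A)"

(* A Jordan normal form is a list of pairs (block size, eigenvalue). It exists for every
   square complex matrix and is unique up to the order of the blocks, so it does not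
   matter which one is inspected below (see defective_eigenvalue_iff). *)
definition semisimple_eigenvalue :: "complex mat \<Rightarrow> complex \<Rightarrow> bool" where
  "semisimple_eigenvalue A k \<longleftrightarrow> eigenvalue A k \<and>
     (\<exists>n_as. jordan_nf A n_as \<and> (\<forall>n. (n, k) \<in> set n_as \<longrightarrow> n = 1))"

definition defective_eigenvalue :: "complex mat \<Rightarrow> complex \<Rightarrow> bool" where
  "defective_eigenvalue A k \<longleftrightarrow> eigenvalue A k \<and>
     (\<exists>n_as. jordan_nf A n_as \<and> (\<exists>n > 1. (n, k) \<in> set n_as))"

lemma jordan_nf_same_blocks:
  fixes A :: "complex mat"
  assumes "jordan_nf A xs" "jordan_nf A ys"
  shows "set xs = set ys"
proof -
  have sub: "set us \<subseteq> set vs" if u: "jordan_nf A us" and v: "jordan_nf A vs" for us vs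
  proof
    fix p assume p: "p \<in> set us"
    obtain n k where nk: "p = (n, k)" by (cases p)
    have n0: "n \<noteq> 0" using u p nk unfolding jordan_nf_def by force
    have "length (filter ((=) (n, k)) us) = length (filter ((=) (n, k)) vs)"
      using compute_nr_of_jordan_blocks[OF u n0] compute_nr_of_jordan_blocks[OF v n0] by metis
    moreover have "filter ((=) (n, k)) us \<noteq> []" using p nk by (auto simp: filter_empty_conv)
    ultimately have "filter ((=) (n, k)) vs \<noteq> []" by (metis length_0_conv)
    then show "p \<in> set vs" using nk by (auto simp: filter_empty_conv)
  qed
  show ?thesis using sub[OF assms] sub[OF assms(2,1)] by blast
qed

lemma defective_eigenvalue_iff:
  assumes A: "A \<in> carrier_mat d d"
  shows "defective_eigenvalue A k \<longleftrightarrow> eigenvalue A k \<and> \<not> semisimple_eigenvalue A k"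
proof -
  obtain as where "char_poly A = (\<Prod>a\<leftarrow>as. [:- a, 1:])"
    using char_poly_factorized[OF A] by blast
  then obtain xs where xs: "jordan_nf A xs" using jordan_nf_exists[OF A] by blast
  have pos: "n \<noteq> 0" if "(n, k) \<in> set xs" for n
    using xs that unfolding jordan_nf_def by force
  have "(\<exists>ys. jordan_nf A ys \<and> P (set ys)) \<longleftrightarrow> P (set xs)" for P
    using xs jordan_nf_same_blocks[OF xs] by metis
  note indep = this[of "\<lambda>S. \<forall>n. (n, k) \<in> S \<longrightarrow> n = 1"]
    this[of "\<lambda>S. \<exists>n > 1. (n, k) \<in> S"]
  have "n = 1 \<longleftrightarrow> \<not> 1 < n" if "(n, k) \<in> set xs" for n
    using pos[OF that] by linarith
  then show ?thesis
    unfolding defective_eigenvalue_def semisimple_eigenvalue_def indep by blast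
qed

end

theory Submission
  imports Defs
begin

text \<open>Write \<open>A = - Bc\<close>. Both parts are instances of one statement: if a real number \<open>\<nu>\<close> bounds
  the real parts of the eigenvalues of \<open>A\<close>, strictly for those that have a Jordan block of size
  larger than one, then some \<open>X > 0\<close> satisfies \<open>X Bc + Bc\<^sup>* X \<ge> -2 \<nu> X\<close>
  (\<open>lyapunov_inequality\<close>). Part (i) takes \<open>\<nu> = \<mu>\<close>, where semi-simplicity gives the strictness for
  large blocks; part (ii) takes \<open>\<nu> = \<mu> + \<epsilon>\<close>, where every inequality is strict.

  To find \<open>X\<close>, change coordinates: for an invertible \<open>T\<close> with \<open>T A = K T\<close> put \<open>X = T\<^sup>* T\<close>. With
  \<open>w = T z\<close> the inequality at \<open>z\<close> says that the real part of \<open>w\<^sup>* K w\<close> is at most \<open>\<nu> w\<^sup>* w\<close>. If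
  \<open>K\<close> is the Jordan form of \<open>A\<close>, this may fail because of the ones above the diagonal. Conjugating
  by a diagonal matrix of powers of a small \<open>\<delta> > 0\<close> turns these ones into \<open>\<delta>\<close>, and they occur only
  inside blocks whose eigenvalue leaves a gap \<open>\<nu> - Re k > 0\<close>. Once \<open>\<delta>\<close> is below all these gaps, the
  off-diagonal entries in each row and in each column of \<open>K\<close> sum to at most the gap, and a
  Gershgorin-type estimate gives the bound (\<open>Re_form_le_of_row_col_sums\<close>,
  \<open>similar_to_form_bounded\<close>).

  The inequality in part (i) cannot be strict, whatever \<open>X\<close> is: on an eigenvector of \<open>A\<close> for an
  eigenvalue with real part \<open>\<mu>\<close> the form of \<open>X Bc + Bc\<^sup>* X + 2 \<mu> X\<close> vanishes
  (\<open>lyapunov_form_eigenvector\<close>).\<close>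

section \<open>Adjoints and quadratic forms\<close>

lemma mat_adjoint_dim [simp]:
  "dim_row (mat_adjoint A) = dim_col A" "dim_col (mat_adjoint A) = dim_row A"
  unfolding mat_adjoint_def by auto

lemma mat_adjoint_carrier [simp]:
  "A \<in> carrier_mat n m \<Longrightarrow> mat_adjoint A \<in> carrier_mat m n"
  by (metis carrier_matD carrier_matI mat_adjoint_dim)

lemma mat_adjoint_index:
  assumes "i < dim_col A" "j < dim_row A"
  shows "mat_adjoint A $$ (i, j) = conjugate (A $$ (j, i))"
  using assms unfolding mat_adjoint_def by (simp add: mat_of_rows_index)

lemma mat_adjoint_adjoint: "mat_adjoint (mat_adjoint A) = (A :: complex mat)"
  by (rule eq_matI) (auto simp: mat_adjoint_index)

lemma mat_adjoint_mult:
  fixes A B :: "complex mat"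
  assumes "A \<in> carrier_mat n m" "B \<in> carrier_mat m k"
  shows "mat_adjoint (A * B) = mat_adjoint B * mat_adjoint A"
  using assms
  by (intro eq_matI) (auto simp: mat_adjoint_index scalar_prod_def mult.commute)

lemma cscalar_prod_adjoint:
  fixes A :: "complex mat"
  assumes A: "A \<in> carrier_mat n m" and u: "u \<in> carrier_vec n" and v: "v \<in> carrier_vec m"
  shows "(mat_adjoint A *\<^sub>v u) \<bullet>c v = u \<bullet>c (A *\<^sub>v v)"
proof -
  have "(mat_adjoint A *\<^sub>v u) \<bullet>c v = (\<Sum>i<m. \<Sum>j<n. cnj (A $$ (j,i)) * u $ j * cnj (v $ i))"
    using assms
    by (auto simp: scalar_prod_def mat_adjoint_index sum_distrib_right lessThan_atLeast0 intro!: sum.cong)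
  also have "\<dots> = (\<Sum>j<n. \<Sum>i<m. cnj (A $$ (j,i)) * u $ j * cnj (v $ i))"
    by (rule sum.swap)
  also have "\<dots> = u \<bullet>c (A *\<^sub>v v)"
    using assms
    by (auto simp: scalar_prod_def sum_distrib_left lessThan_atLeast0 mult_ac intro!: sum.cong)
  finally show ?thesis .
qed

lemma hermitian_gram:
  assumes "T \<in> carrier_mat n m"
  shows "hermitian_mat (mat_adjoint T * T)"
  unfolding hermitian_mat_def
  using mat_adjoint_mult[of "mat_adjoint T" m n T m] assms by (simp add: mat_adjoint_adjoint)

lemma hermitian_diff:
  assumes "A \<in> carrier_mat n n" "B \<in> carrier_mat n n" "hermitian_mat A" "hermitian_mat B"
  shows "hermitian_mat (A - B)"
proof -
  have *: "cnj (M $$ (j, i)) = M $$ (i, j)"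
    if "hermitian_mat M" "M \<in> carrier_mat n n" "i < n" "j < n" for M i j
    using that mat_adjoint_index[of i M j] by (simp add: hermitian_mat_def)
  show ?thesis unfolding hermitian_mat_def
    using assms by (intro eq_matI) (auto simp: mat_adjoint_index *)
qed

lemma hermitian_smult_real:
  assumes "A \<in> carrier_mat n n" "hermitian_mat A"
  shows "hermitian_mat (complex_of_real c \<cdot>\<^sub>m A)"
proof -
  have *: "cnj (A $$ (j, i)) = A $$ (i, j)" if "i < n" "j < n" for i j
    using that assms mat_adjoint_index[of i A j] by (simp add: hermitian_mat_def)
  show ?thesis unfolding hermitian_mat_def
    using assms by (intro eq_matI) (auto simp: mat_adjoint_index *)
qed

lemma smult_mat_mult_vec:
  fixes A :: "complex mat"
  assumes "A \<in> carrier_mat n m" "v \<in> carrier_vec m"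
  shows "(c \<cdot>\<^sub>m A) *\<^sub>v v = c \<cdot>\<^sub>v (A *\<^sub>v v)"
  using assms by (intro eq_vecI) auto

lemma hermitian_lyapunov:
  assumes X: "X \<in> carrier_mat n n" "hermitian_mat X" and B: "B \<in> carrier_mat n n"
  shows "hermitian_mat (X * B + mat_adjoint B * X)"
proof -
  have XB: "mat_adjoint (X * B) = mat_adjoint B * X"
    using mat_adjoint_mult[OF X(1) B] X(2) by (simp add: hermitian_mat_def)
  show ?thesis unfolding hermitian_mat_def XB[symmetric]
    using X B by (intro eq_matI) (auto simp: mat_adjoint_index)
qed

text \<open>The two summands contribute complex conjugate numbers, since \<open>X\<close> is Hermitian.\<close>
lemma lyapunov_form:
  assumes X: "X \<in> carrier_mat n n" "hermitian_mat X" and B: "B \<in> carrier_mat n n"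
    and z: "z \<in> carrier_vec n"
  shows "((X * B + mat_adjoint B * X) *\<^sub>v z) \<bullet>c z
           = complex_of_real (2 * Re ((X *\<^sub>v (B *\<^sub>v z)) \<bullet>c z))"
proof -
  let ?u = "B *\<^sub>v z"
  have u: "?u \<in> carrier_vec n" and Xz: "X *\<^sub>v z \<in> carrier_vec n" using X B z by auto
  have 1: "(mat_adjoint B *\<^sub>v (X *\<^sub>v z)) \<bullet>c z = (X *\<^sub>v z) \<bullet>c ?u"
    by (rule cscalar_prod_adjoint[OF B Xz z])
  have "(X *\<^sub>v ?u) \<bullet>c z = ?u \<bullet>c (X *\<^sub>v z)"
    using cscalar_prod_adjoint[OF X(1) u z] X(2) by (simp add: hermitian_mat_def)
  then have "conjugate ((X *\<^sub>v ?u) \<bullet>c z) = (X *\<^sub>v z) \<bullet>c ?u"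
    using u Xz by (metis conjugate_conjugate_sprod conjugate_vec_sprod_comm)
  then have 2: "(X *\<^sub>v z) \<bullet>c ?u = cnj ((X *\<^sub>v ?u) \<bullet>c z)" by simp
  have "(X * B + mat_adjoint B * X) *\<^sub>v z = X *\<^sub>v ?u + mat_adjoint B *\<^sub>v (X *\<^sub>v z)"
    using X B z by (subst add_mult_distrib_mat_vec[of _ n n])
        (auto simp: assoc_mult_mat_vec[of _ n n _ n] intro!: mult_carrier_mat[of _ n n])
  then have "((X * B + mat_adjoint B * X) *\<^sub>v z) \<bullet>c z
      = (X *\<^sub>v ?u) \<bullet>c z + (mat_adjoint B *\<^sub>v (X *\<^sub>v z)) \<bullet>c z"
    using X B z u Xz
    by (simp add: add_scalar_prod_distrib[of _ n] mult_mat_vec_carrier[of _ n n])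
  then show ?thesis unfolding 1 2 complex_add_cnj by simp
qed

lemma cscalar_self_real:
  fixes w :: "complex vec"
  shows "w \<bullet>c w = complex_of_real (\<Sum>i<dim_vec w. (cmod (w $ i))\<^sup>2)"
  unfolding of_real_sum complex_norm_square by (simp add: scalar_prod_def lessThan_atLeast0)

section \<open>Bounding the real part of a quadratic form\<close>

text \<open>A quadratic-form version of Gershgorin's theorem. By the inequality of arithmetic and geometric
  means, the entry at \<open>(i, j)\<close> contributes at most its modulus times the mean of \<open>|w\<^sub>i|\<^sup>2\<close> and
  \<open>|w\<^sub>j|\<^sup>2\<close>. Hence \<open>|w\<^sub>i|\<^sup>2\<close> collects half of the off-diagonal sum of row \<open>i\<close> and half of that of
  column \<open>i\<close>.\<close>
lemma Re_form_le_of_row_col_sums: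
  assumes K: "K \<in> carrier_mat n n" and w: "w \<in> carrier_vec n"
    and row: "\<And>i. i < n \<Longrightarrow> Re (K $$ (i,i)) + (\<Sum>j\<in>{..<n}-{i}. cmod (K $$ (i,j))) \<le> \<nu>"
    and col: "\<And>i. i < n \<Longrightarrow> Re (K $$ (i,i)) + (\<Sum>j\<in>{..<n}-{i}. cmod (K $$ (j,i))) \<le> \<nu>"
  shows "Re ((K *\<^sub>v w) \<bullet>c w) \<le> \<nu> * Re (w \<bullet>c w)"
proof -
  define a where "a i = (cmod (w $ i))\<^sup>2" for i
  have offd: "(\<Sum>j\<in>{..<n}-{i}. f j) = (\<Sum>j<n. if j = i then 0 else f j)" for i and f :: "nat \<Rightarrow> real"
    by (rule sum.mono_neutral_cong_left) auto
  define c where "c i j = (if j = i then 0 else cmod (K $$ (i,j)))" for i j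
  have entry: "Re (K $$ (i,j) * w $ j * cnj (w $ i))
      \<le> (if j = i then Re (K $$ (i,i)) * a i else 0) + (c i j * a i + c i j * a j) / 2" for i j
  proof (cases "j = i")
    case True
    have "K $$ (i,i) * w $ i * cnj (w $ i) = K $$ (i,i) * complex_of_real (a i)"
      unfolding a_def complex_norm_square by (simp only: mult.assoc)
    then have "Re (K $$ (i,i) * w $ i * cnj (w $ i)) = Re (K $$ (i,i)) * a i"
      by (simp only: Re_complex_of_real Im_complex_of_real times_complex.sel mult_zero_right diff_zero)
    then show ?thesis unfolding True by (simp add: c_def)
  next
    case False
    have "Re (K $$ (i,j) * w $ j * cnj (w $ i)) \<le> cmod (K $$ (i,j) * w $ j * cnj (w $ i))"
      by (rule complex_Re_le_cmod)
    also have "\<dots> = c i j * (cmod (w $ j) * cmod (w $ i))"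
      using False by (simp add: c_def norm_mult)
    also have "\<dots> \<le> c i j * ((a i + a j) / 2)"
      using sum_squares_bound[of "cmod (w $ j)" "cmod (w $ i)"]
      by (intro mult_left_mono) (auto simp: c_def a_def)
    finally show ?thesis using False by (simp add: algebra_simps)
  qed
  have "Re ((K *\<^sub>v w) \<bullet>c w) = (\<Sum>i<n. \<Sum>j<n. Re (K $$ (i,j) * w $ j * cnj (w $ i)))"
    using K w by (auto simp: scalar_prod_def sum_distrib_right lessThan_atLeast0 intro!: sum.cong)
  also have "\<dots> \<le> (\<Sum>i<n. \<Sum>j<n. (if j = i then Re (K $$ (i,i)) * a i else 0)
                       + (c i j * a i + c i j * a j) / 2)"
    by (intro sum_mono entry)
  also have "\<dots> = (\<Sum>i<n. Re (K $$ (i,i)) * a i) + (\<Sum>i<n. \<Sum>j<n. c i j * a i) / 2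
                     + (\<Sum>i<n. \<Sum>j<n. c i j * a j) / 2"
    by (simp add: sum.distrib sum_divide_distrib add_divide_distrib)
  also have "(\<Sum>i<n. \<Sum>j<n. c i j * a j) = (\<Sum>i<n. \<Sum>j<n. c j i * a i)"
    by (rule sum.swap)
  also have "(\<Sum>i<n. Re (K $$ (i,i)) * a i) + (\<Sum>i<n. \<Sum>j<n. c i j * a i) / 2
                     + (\<Sum>i<n. \<Sum>j<n. c j i * a i) / 2
      = (\<Sum>i<n. a i * (Re (K $$ (i,i)) + ((\<Sum>j<n. c i j) + (\<Sum>j<n. c j i)) / 2))"
    by (simp add: sum.distrib sum_divide_distrib sum_distrib_left sum_distrib_right
        algebra_simps add_divide_distrib)
  also have "\<dots> \<le> (\<Sum>i<n. a i * \<nu>)"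
  proof (rule sum_mono)
    fix i assume i: "i \<in> {..<n}"
    have "(\<Sum>j<n. c i j) = (\<Sum>j\<in>{..<n}-{i}. cmod (K $$ (i,j)))"
         "(\<Sum>j<n. c j i) = (\<Sum>j\<in>{..<n}-{i}. cmod (K $$ (j,i)))"
      unfolding offd c_def by (auto intro!: sum.cong)
    then have "Re (K $$ (i,i)) + ((\<Sum>j<n. c i j) + (\<Sum>j<n. c j i)) / 2 \<le> \<nu>"
      using row[of i] col[of i] i by (simp add: field_simps)
    then show "a i * (Re (K $$ (i,i)) + ((\<Sum>j<n. c i j) + (\<Sum>j<n. c j i)) / 2) \<le> a i * \<nu>"
      by (intro mult_left_mono) (auto simp: a_def)
  qed
  also have "\<dots> = \<nu> * Re (w \<bullet>c w)"
    using w unfolding cscalar_self_real by (simp add: a_def sum_distrib_left mult.commute)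
  finally show ?thesis .
qed

section \<open>Jordan matrices\<close>

lemma jordan_matrix_diag:
  assumes "i < sum_list (map fst n_as)"
  shows "\<exists>n. (n, jordan_matrix n_as $$ (i,i)) \<in> set n_as"
  using assms
proof (induction n_as arbitrary: i)
  case (Cons p n_as)
  obtain n a where p: "p = (n, a)" by (cases p)
  show ?case
  proof (cases "i < n")
    case True
    then show ?thesis using Cons.prems p
      by (auto simp: jordan_matrix_Cons jordan_block_def)
  next
    case False
    then have "i - n < sum_list (map fst n_as)" using Cons.prems p by auto
    from Cons.IH[OF this] obtain n'
      where "(n', jordan_matrix n_as $$ (i - n, i - n)) \<in> set n_as" by blast
    moreover have "jordan_matrix (p # n_as) $$ (i, i) = jordan_matrix n_as $$ (i - n, i - n)"
      using False Cons.prems p by (simp add: jordan_matrix_Cons)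
    ultimately show ?thesis by auto
  qed
qed simp

lemma jordan_matrix_offdiag:
  fixes n_as :: "(nat \<times> 'a :: zero_neq_one) list"
  assumes "i < sum_list (map fst n_as)" "j < sum_list (map fst n_as)" "i \<noteq> j"
    and "jordan_matrix n_as $$ (i,j) \<noteq> 0"
  shows "j = Suc i \<and> jordan_matrix n_as $$ (i,j) = 1
    \<and> jordan_matrix n_as $$ (i,i) = jordan_matrix n_as $$ (j,j)
    \<and> (\<exists>n>1. (n, jordan_matrix n_as $$ (i,i)) \<in> set n_as)"
  using assms
proof (induction n_as arbitrary: i j)
  case (Cons p n_as)
  obtain n a where p: "p = (n, a)" by (cases p)
  consider "i < n" "j < n" | "i \<ge> n" "j \<ge> n" | "i < n" "j \<ge> n" | "i \<ge> n" "j < n" by linarith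
  then show ?case
  proof cases
    case 1
    then show ?thesis using Cons.prems p
      by (auto simp: jordan_matrix_Cons jordan_block_def split: if_splits intro!: exI[of _ n])
  next
    case 2
    have shift: "jordan_matrix (p # n_as) $$ (i', j') = jordan_matrix n_as $$ (i' - n, j' - n)"
      if "n \<le> i'" "n \<le> j'" "i' < sum_list (map fst (p # n_as))"
        "j' < sum_list (map fst (p # n_as))" for i' j'
      using that p by (auto simp: jordan_matrix_Cons)
    have "i - n < sum_list (map fst n_as)" "j - n < sum_list (map fst n_as)" "i - n \<noteq> j - n"
      using 2 Cons.prems(1-3) p by auto
    moreover have "jordan_matrix n_as $$ (i - n, j - n) \<noteq> 0"
      using Cons.prems(4) shift[OF 2 Cons.prems(1,2)] by simp
    ultimately have IH: "j - n = Suc (i - n) \<and> jordan_matrix n_as $$ (i-n,j-n) = 1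
      \<and> jordan_matrix n_as $$ (i-n,i-n) = jordan_matrix n_as $$ (j-n,j-n)
      \<and> (\<exists>n'>1. (n', jordan_matrix n_as $$ (i-n,i-n)) \<in> set n_as)"
      by (rule Cons.IH[of "i - n" "j - n"])
    moreover have "j = Suc i" using IH 2 by linarith
    ultimately show ?thesis
      using 2 Cons.prems(1,2) by (auto simp: shift)
  qed (use Cons.prems p in \<open>auto simp: jordan_matrix_Cons\<close>)
qed simp

lemma jordan_nf_block_eigenvalue:
  fixes A :: "complex mat"
  assumes A: "A \<in> carrier_mat d d" and J: "jordan_nf A n_as" and k: "(n, k) \<in> set n_as"
  shows "eigenvalue A k"
proof -
  have "n \<noteq> 0" using J k unfolding jordan_nf_def by force
  then have "poly ([:- k, 1:] ^ n) k = 0" by simp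
  then have "poly (char_poly A) k = 0"
    unfolding jordan_nf_char_poly[OF J] poly_prod_list prod_list_zero_iff using k by force
  then show ?thesis using eigenvalue_root_char_poly[OF A] by simp
qed

text \<open>The similarity that makes the ones of the Jordan form small. The matrix \<open>L\<close> records that
  \<open>T\<close> is invertible.\<close>
lemma similar_to_form_bounded:
  fixes A :: "complex mat"
  assumes A: "A \<in> carrier_mat d d" and J: "jordan_nf A n_as"
    and blocks: "\<forall>(n, k) \<in> set n_as. Re k \<le> \<nu> \<and> (n > 1 \<longrightarrow> Re k < \<nu>)"
  obtains T L K where "T \<in> carrier_mat d d" "L \<in> carrier_mat d d" "K \<in> carrier_mat d d"
    "L * T = 1\<^sub>m d" "T * A = K * T"
    "\<And>w. w \<in> carrier_vec d \<Longrightarrow> Re ((K *\<^sub>v w) \<bullet>c w) \<le> \<nu> * Re (w \<bullet>c w)"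
proof -
  have le: "Re k \<le> \<nu>" if "(n, k) \<in> set n_as" for n k
    using blocks that by auto
  have semi: "Re k < \<nu>" if "(n, k) \<in> set n_as" "n > 1" for n k
    using blocks that by auto
  define J where "J = jordan_matrix n_as"
  obtain P Q where PQ: "A = P * J * Q" "P * Q = 1\<^sub>m d" "Q * P = 1\<^sub>m d"
    and PQc: "P \<in> carrier_mat d d" "Q \<in> carrier_mat d d" "J \<in> carrier_mat d d"
  proof -
    have "similar_mat A J" using J unfolding jordan_nf_def J_def by simp
    from similar_matD[OF this] A show ?thesis by (auto intro!: that)
  qed
  have d: "d = sum_list (map fst n_as)" using PQc(3) unfolding J_def by auto
  \<comment> \<open>The element 1 serves only to make the minimum exist when all blocks have size one.\<close>
  define gaps where "gaps = (\<lambda>(n, k). \<nu> - Re k) ` {p \<in> set n_as. fst p > 1}"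
  define \<delta> where "\<delta> = Min (insert 1 gaps)"
  have fin: "finite (insert 1 gaps)" unfolding gaps_def by auto
  have \<delta>pos: "\<delta> > 0" unfolding \<delta>_def using fin semi by (auto simp: gaps_def)
  have \<delta>le: "\<delta> \<le> \<nu> - Re k" if "(n, k) \<in> set n_as" "n > 1" for n k
    unfolding \<delta>_def using fin that by (intro Min_le) (force simp: gaps_def)+
  \<comment> \<open>\<open>K = E J F\<close> with \<open>E\<close>, \<open>F\<close> below: exponents follow the global index, not the position
    inside a block, as every nonzero off-diagonal entry of \<open>J\<close> lies at some \<open>(i, Suc i)\<close>.\<close>
  define K where "K = mat d d (\<lambda>(i,j). J $$ (i,j) * complex_of_real \<delta> ^ j / complex_of_real \<delta> ^ i)"
  define E where "E = mat_diag d (\<lambda>i. 1 / complex_of_real \<delta> ^ i)"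
  define F where "F = mat_diag d (\<lambda>i. complex_of_real \<delta> ^ i)"
  have K: "K \<in> carrier_mat d d" and E: "E \<in> carrier_mat d d" and F: "F \<in> carrier_mat d d"
    by (auto simp: K_def E_def F_def)
  have EJ: "E * J = K * E" 
    unfolding E_def mat_diag_mult_left[OF PQc(3)] mat_diag_mult_right[OF K]
    using \<delta>pos by (intro eq_matI) (auto simp: K_def)
  have FE: "F * E = 1\<^sub>m d"
    unfolding E_def F_def mat_diag_diag using \<delta>pos by (intro eq_matI) (auto simp: mat_diag_def)
  have Jdiag: "\<exists>n. (n, J $$ (i,i)) \<in> set n_as" if "i < d" for i
    using jordan_matrix_diag[of i n_as] that unfolding J_def d by simp
  have off: "j = Suc i \<and> K $$ (i,j) = complex_of_real \<delta> \<and> \<delta> \<le> \<nu> - Re (J $$ (i,i))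
      \<and> \<delta> \<le> \<nu> - Re (J $$ (j,j))"
    if "i < d" "j < d" "i \<noteq> j" "K $$ (i,j) \<noteq> 0" for i j
  proof -
    have "J $$ (i,j) \<noteq> 0" using that by (auto simp: K_def)
    from jordan_matrix_offdiag[OF _ _ that(3), of n_as] this that
    have *: "j = Suc i" "J $$ (i,j) = 1" "J $$ (i,i) = J $$ (j,j)"
      and "\<exists>n>1. (n, J $$ (i,i)) \<in> set n_as"
      unfolding J_def d by blast+
    then show ?thesis using \<delta>le \<delta>pos that(1,2) by (auto simp: K_def)
  qed
  have Kdiag: "K $$ (i,i) = J $$ (i,i)" if "i < d" for i using that \<delta>pos by (auto simp: K_def)
  have bound: "Re ((K *\<^sub>v w) \<bullet>c w) \<le> \<nu> * Re (w \<bullet>c w)" if w: "w \<in> carrier_vec d" for w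
  proof (rule Re_form_le_of_row_col_sums[OF K w])
    fix i assume i: "i < d"
    have g: "0 \<le> \<nu> - Re (J $$ (i,i))" using Jdiag[OF i] le by fastforce
    have "(\<Sum>j\<in>{..<d}-{i}. cmod (K $$ (i,j)))
        \<le> (\<Sum>j\<in>{..<d}-{i}. if j = Suc i then \<nu> - Re (J $$ (i,i)) else 0)"
    proof (intro sum_mono)
      fix j assume "j \<in> {..<d} - {i}"
      then show "cmod (K $$ (i,j)) \<le> (if j = Suc i then \<nu> - Re (J $$ (i,i)) else 0)"
        using off[OF i, of j] g \<delta>pos by (cases "K $$ (i,j) = 0") auto
    qed
    also have "\<dots> \<le> \<nu> - Re (J $$ (i,i))" using g by (simp add: sum.delta)
    finally show "Re (K $$ (i,i)) + (\<Sum>j\<in>{..<d}-{i}. cmod (K $$ (i,j))) \<le> \<nu>"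
      using Kdiag[OF i] by simp
    \<comment> \<open>For \<open>i = 0\<close> the truncated index \<open>i - 1\<close> is \<open>i\<close> itself, which is outside the range of the
      sum; the bound is then 0, as it should be.\<close>
    have "(\<Sum>j\<in>{..<d}-{i}. cmod (K $$ (j,i)))
        \<le> (\<Sum>j\<in>{..<d}-{i}. if j = i - 1 then \<nu> - Re (J $$ (i,i)) else 0)"
    proof (intro sum_mono)
      fix j assume "j \<in> {..<d} - {i}"
      then show "cmod (K $$ (j,i)) \<le> (if j = i - 1 then \<nu> - Re (J $$ (i,i)) else 0)"
        using off[OF _ i, of j] g \<delta>pos by (cases "K $$ (j,i) = 0") auto
    qed
    also have "\<dots> \<le> \<nu> - Re (J $$ (i,i))" using g by (simp add: sum.delta)
    finally show "Re (K $$ (i,i)) + (\<Sum>j\<in>{..<d}-{i}. cmod (K $$ (j,i))) \<le> \<nu>"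
      using Kdiag[OF i] by simp
  qed
  show thesis
  proof (rule that[OF _ _ K _ _ bound])
    show "E * Q \<in> carrier_mat d d" "P * F \<in> carrier_mat d d" using PQc E F by auto
    have "(P * F) * (E * Q) = P * ((F * E) * Q)"
      using PQc E F by (simp add: assoc_mult_mat[of _ d d _ d _ d])
    then show "(P * F) * (E * Q) = 1\<^sub>m d" using FE PQc PQ by simp
    have "E * Q * A = E * ((Q * P) * (J * Q))"
      unfolding PQ(1) using PQc E by (simp add: assoc_mult_mat[of _ d d _ d _ d])
    also have "\<dots> = (E * J) * Q" using PQ PQc E by (simp add: assoc_mult_mat[of _ d d _ d _ d])
    also have "\<dots> = K * (E * Q)" unfolding EJ using PQc E K by (simp add: assoc_mult_mat[of _ d d _ d _ d])
    finally show "E * Q * A = K * (E * Q)" .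
  qed
qed

section \<open>The Lyapunov inequality\<close>

text \<open>With \<open>X = T\<^sup>* T\<close> and \<open>T (- B) = K T\<close>, the form of \<open>X B + B\<^sup>* X + 2 \<nu> X\<close> at \<open>z\<close> is twice
  \<open>\<nu> w\<^sup>* w - Re (w\<^sup>* K w)\<close> for \<open>w = T z\<close>.\<close>
lemma lyapunov_inequality:
  fixes B :: "complex mat"
  assumes B: "B \<in> carrier_mat d d" and J: "jordan_nf (- B) n_as"
    and blocks: "\<forall>(n, k) \<in> set n_as. Re k \<le> \<nu> \<and> (n > 1 \<longrightarrow> Re k < \<nu>)"
  shows "\<exists>X \<in> carrier_mat d d. pos_def_mat X \<and>
    loewner_le (complex_of_real (- 2 * \<nu>) \<cdot>\<^sub>m X) (X * B + mat_adjoint B * X)"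
proof -
  have mB: "- B \<in> carrier_mat d d" using B by simp
  obtain T L K where T: "T \<in> carrier_mat d d" and L: "L \<in> carrier_mat d d"
    and K: "K \<in> carrier_mat d d" and LT: "L * T = 1\<^sub>m d" and TK: "T * - B = K * T"
    and bound: "\<And>w. w \<in> carrier_vec d \<Longrightarrow> Re ((K *\<^sub>v w) \<bullet>c w) \<le> \<nu> * Re (w \<bullet>c w)"
    using similar_to_form_bounded[OF mB J blocks] by metis
  define X where "X = mat_adjoint T * T"
  have X: "X \<in> carrier_mat d d" unfolding X_def by (rule mult_carrier_mat[OF mat_adjoint_carrier[OF T] T])
  have XH: "hermitian_mat X" unfolding X_def by (rule hermitian_gram[OF T])
  have Xform: "(X *\<^sub>v u) \<bullet>c v = (T *\<^sub>v u) \<bullet>c (T *\<^sub>v v)"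
    if "u \<in> carrier_vec d" "v \<in> carrier_vec d" for u v
    unfolding X_def using that T cscalar_prod_adjoint[OF T, of "T *\<^sub>v u" v]
    by (simp add: assoc_mult_mat_vec[OF mat_adjoint_carrier[OF T] T])
  have pd: "pos_def_mat X"
    unfolding pos_def_mat_def
  proof (intro conjI XH ballI impI)
    fix z :: "complex vec"
    assume "z \<in> carrier_vec (dim_row X)" "z \<noteq> 0\<^sub>v (dim_row X)"
    then have z: "z \<in> carrier_vec d" and z0: "z \<noteq> 0\<^sub>v d" using X by auto
    have Tz: "T *\<^sub>v z \<in> carrier_vec d" using T z by simp
    have "L *\<^sub>v (T *\<^sub>v z) = z"
      using assoc_mult_mat_vec[OF L T z] LT z by simp
    moreover have "L *\<^sub>v 0\<^sub>v d = 0\<^sub>v d" using L by (intro eq_vecI) auto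
    ultimately have "T *\<^sub>v z \<noteq> 0\<^sub>v d" using z0 by auto
    then show "0 < (X *\<^sub>v z) \<bullet>c z" using Xform[OF z z] Tz by simp
  qed
  let ?R = "X * B + mat_adjoint B * X"
  let ?S = "complex_of_real (- 2 * \<nu>) \<cdot>\<^sub>m X"
  have R: "?R \<in> carrier_mat d d" and S: "?S \<in> carrier_mat d d"
    using X B mat_adjoint_carrier[OF B] by auto
  have RH: "hermitian_mat ?R" by (rule hermitian_lyapunov[OF X XH B])
  have SH: "hermitian_mat ?S" by (rule hermitian_smult_real[OF X XH])
  have "pos_semidef_mat (?R - ?S)"
    unfolding pos_semidef_mat_def
  proof (intro conjI ballI)
    show "hermitian_mat (?R - ?S)" by (rule hermitian_diff[OF R S RH SH])
    fix z :: "complex vec"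
    assume "z \<in> carrier_vec (dim_row (?R - ?S))"
    then have z: "z \<in> carrier_vec d" using X by simp
    define w where "w = T *\<^sub>v z"
    have w: "w \<in> carrier_vec d" using T z by (simp add: w_def)
    have Bz: "B *\<^sub>v z \<in> carrier_vec d" using B z by simp
    have "K *\<^sub>v w = (T * - B) *\<^sub>v z" unfolding TK w_def using K T z by simp
    also have "\<dots> = - (T *\<^sub>v (B *\<^sub>v z))" 
      using T B z by (intro eq_vecI) auto
    finally have "T *\<^sub>v (B *\<^sub>v z) = - (K *\<^sub>v w)" using T Bz by simp
    then have "(X *\<^sub>v (B *\<^sub>v z)) \<bullet>c z = - ((K *\<^sub>v w) \<bullet>c w)"
      using Xform[OF Bz z] K w by (simp add: w_def[symmetric])
    then have form: "(?R *\<^sub>v z) \<bullet>c z = complex_of_real (- 2 * Re ((K *\<^sub>v w) \<bullet>c w))"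
      using lyapunov_form[OF X XH B z] by simp
    have "(?S *\<^sub>v z) \<bullet>c z = complex_of_real (- 2 * \<nu>) * ((X *\<^sub>v z) \<bullet>c z)"
      using X z by (subst smult_mat_mult_vec[of _ d d]) auto
    also have "\<dots> = complex_of_real (- 2 * \<nu> * Re (w \<bullet>c w))"
      using Xform[OF z z] by (simp add: w_def[symmetric] cscalar_self_real)
    finally have formS: "(?S *\<^sub>v z) \<bullet>c z = complex_of_real (- 2 * \<nu> * Re (w \<bullet>c w))" .
    have "((?R - ?S) *\<^sub>v z) \<bullet>c z = (?R *\<^sub>v z) \<bullet>c z - (?S *\<^sub>v z) \<bullet>c z"
      using R S z by (simp add: minus_mult_distrib_mat_vec[of _ d d] minus_scalar_prod_distrib[of _ d] 
          mult_mat_vec_carrier[of _ d d])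
    also have "\<dots> = complex_of_real (2 * (\<nu> * Re (w \<bullet>c w) - Re ((K *\<^sub>v w) \<bullet>c w)))"
      unfolding form formS by simp
    finally show "0 \<le> ((?R - ?S) *\<^sub>v z) \<bullet>c z" using bound[OF w] by (simp add: less_eq_complex_def)
  qed
  then have "loewner_le ?S ?R" using RH SH X B by (simp add: loewner_le_def)
  then show ?thesis using X pd by blast
qed

text \<open>From \<open>B z = - k z\<close>, the form of \<open>X B + B\<^sup>* X\<close> at \<open>z\<close> is \<open>- 2 Re k\<close> times the real number
  \<open>z\<^sup>* X z\<close>. The case of interest is an eigenvalue \<open>k\<close> whose real part is the spectral abscissa.\<close>
lemma lyapunov_form_eigenvector:
  assumes X: "X \<in> carrier_mat d d" "hermitian_mat X" and B: "B \<in> carrier_mat d d"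
    and z: "eigenvector (- B) z k"
  shows "((X * B + mat_adjoint B * X + complex_of_real (2 * Re k) \<cdot>\<^sub>m X) *\<^sub>v z) \<bullet>c z = 0"
proof -
  have zc: "z \<in> carrier_vec d" and ev: "(- B) *\<^sub>v z = k \<cdot>\<^sub>v z"
    using z B unfolding eigenvector_def by auto
  have Xz: "X *\<^sub>v z \<in> carrier_vec d" using X zc by simp
  have "(- B) *\<^sub>v z = - (B *\<^sub>v z)" using B zc by (intro eq_vecI) auto
  then have "B *\<^sub>v z = - (k \<cdot>\<^sub>v z)" using ev by (metis uminus_uminus_vec)
  then have "B *\<^sub>v z = (- k) \<cdot>\<^sub>v z" by (auto simp: vec_eq_iff)
  then have form: "(X *\<^sub>v (B *\<^sub>v z)) \<bullet>c z = - k * ((X *\<^sub>v z) \<bullet>c z)"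
    using X zc Xz by (simp add: mult_mat_vec[of _ d d])
  have "(X *\<^sub>v z) \<bullet>c z = z \<bullet>c (X *\<^sub>v z)"
    using cscalar_prod_adjoint[OF X(1) zc zc] X(2) by (simp add: hermitian_mat_def)
  then have real: "cnj ((X *\<^sub>v z) \<bullet>c z) = (X *\<^sub>v z) \<bullet>c z"
    using zc Xz by (metis carrier_vec_conjugate conjugate_conjugate_sprod conjugate_vec_sprod_comm
        conjugate_id comm_scalar_prod conjugate_complex_def)
  then have real: "(X *\<^sub>v z) \<bullet>c z = complex_of_real (Re ((X *\<^sub>v z) \<bullet>c z))"
    by (metis Reals_cnj_iff of_real_Re)
  have R: "X * B + mat_adjoint B * X \<in> carrier_mat d d"
    using X B mat_adjoint_carrier[OF B] by auto
  have "((X * B + mat_adjoint B * X + complex_of_real (2 * Re k) \<cdot>\<^sub>m X) *\<^sub>v z) \<bullet>c z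
     = ((X * B + mat_adjoint B * X) *\<^sub>v z) \<bullet>c z + complex_of_real (2 * Re k) * ((X *\<^sub>v z) \<bullet>c z)"
    using R X zc Xz
    by (subst add_mult_distrib_mat_vec[of _ d d]) (auto simp: add_scalar_prod_distrib[of _ d] 
        mult_mat_vec_carrier[of _ d d] smult_mat_mult_vec[of _ d d])
  also have "\<dots> = 0"
    unfolding lyapunov_form[OF X B zc] form by (subst (1 2) real) simp
  finally show ?thesis .
qed

lemma spectral_abscissa_attained:
  assumes A: "A \<in> carrier_mat d d" and d: "d \<ge> 1"
  shows "\<exists>k. eigenvalue A k \<and> Re k = spectral_abscissa A"
    and "eigenvalue A k \<Longrightarrow> Re k \<le> spectral_abscissa A"
proof -
  have fin: "finite (Re ` spectrum A)" using card_finite_spectrum[OF A] by simp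
  have ne: "Re ` spectrum A \<noteq> {}" using spectrum_non_empty[OF A] d by simp
  show "\<exists>k. eigenvalue A k \<and> Re k = spectral_abscissa A"
    using Max_in[OF fin ne] unfolding spectral_abscissa_def by (auto simp: spectrum_def)
  show "eigenvalue A k \<Longrightarrow> Re k \<le> spectral_abscissa A"
    unfolding spectral_abscissa_def by (rule Max_ge[OF fin]) (auto simp: spectrum_def)
qed

section \<open>The two cases\<close>

theorem lemma6p1:
  fixes d :: nat and Bc :: "complex mat" and \<mu> :: real
  assumes "d \<ge> 1"
    and "Bc \<in> carrier_mat d d"
    and "\<forall>k. eigenvalue (- Bc) k \<longrightarrow> Re k < 0"
    and "\<mu> = spectral_abscissa (- Bc)"
  shows
    "((\<forall>k. eigenvalue (- Bc) k \<and> Re k = \<mu> \<longrightarrow> semisimple_eigenvalue (- Bc) k) \<longrightarrow>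
        (\<exists>X \<in> carrier_mat d d. pos_def_mat X \<and>
           loewner_le (complex_of_real (- 2 * \<mu>) \<cdot>\<^sub>m X) (X * Bc + mat_adjoint Bc * X) \<and>
           (\<exists>z \<in> carrier_vec d. z \<noteq> 0\<^sub>v d \<and>
              ((X * Bc + mat_adjoint Bc * X + complex_of_real (2 * \<mu>) \<cdot>\<^sub>m X) *\<^sub>v z) \<bullet>c z = 0)))
     \<and>
     ((\<exists>k. defective_eigenvalue (- Bc) k \<and> Re k = \<mu>) \<longrightarrow>
        (\<forall>\<epsilon> > 0. \<exists>X \<in> carrier_mat d d. pos_def_mat X \<and>
           loewner_le (complex_of_real (- 2 * (\<mu> + \<epsilon>)) \<cdot>\<^sub>m X) (X * Bc + mat_adjoint Bc * X)))"
proof -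
  have A: "- Bc \<in> carrier_mat d d" using assms(2) by simp
  obtain as where "char_poly (- Bc) = (\<Prod>a\<leftarrow>as. [:- a, 1:])"
    using char_poly_factorized[OF A] by blast
  then obtain xs where xs: "jordan_nf (- Bc) xs" using jordan_nf_exists[OF A] by blast
  have ev: "eigenvalue (- Bc) k" if "(n, k) \<in> set xs" for n k
    using jordan_nf_block_eigenvalue[OF A xs that] .
  have le: "Re k \<le> \<mu>" if "(n, k) \<in> set xs" for n k
    using spectral_abscissa_attained(2)[OF A assms(1) ev[OF that]] assms(4) by simp
  show ?thesis
  proof (intro conjI impI allI)
    assume ss: "\<forall>k. eigenvalue (- Bc) k \<and> Re k = \<mu> \<longrightarrow> semisimple_eigenvalue (- Bc) k"
    have "Re k < \<mu>" if "(n, k) \<in> set xs" "n > 1" for n k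
    proof (rule ccontr)
      assume "\<not> Re k < \<mu>"
      then have "semisimple_eigenvalue (- Bc) k" using le[OF that(1)] ev[OF that(1)] ss by auto
      then show False using that jordan_nf_same_blocks[OF xs]
        unfolding semisimple_eigenvalue_def by fastforce
    qed
    then have "\<forall>(n, k) \<in> set xs. Re k \<le> \<mu> \<and> (n > 1 \<longrightarrow> Re k < \<mu>)"
      using le by auto
    from lyapunov_inequality[OF assms(2) xs this]
    obtain X where X: "X \<in> carrier_mat d d" "pos_def_mat X"
      "loewner_le (complex_of_real (- 2 * \<mu>) \<cdot>\<^sub>m X) (X * Bc + mat_adjoint Bc * X)" by blast
    obtain k z where k: "Re k = \<mu>" and z: "eigenvector (- Bc) z k"
      using spectral_abscissa_attained(1)[OF A assms(1)] assms(4) unfolding eigenvalue_def by auto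
    have "z \<in> carrier_vec d" "z \<noteq> 0\<^sub>v d" using z A unfolding eigenvector_def by auto
    moreover have "((X * Bc + mat_adjoint Bc * X + complex_of_real (2 * \<mu>) \<cdot>\<^sub>m X) *\<^sub>v z) \<bullet>c z = 0"
      using lyapunov_form_eigenvector[OF X(1) _ assms(2) z] X(2) k by (simp add: pos_def_mat_def)
    ultimately show "\<exists>X \<in> carrier_mat d d. pos_def_mat X \<and>
           loewner_le (complex_of_real (- 2 * \<mu>) \<cdot>\<^sub>m X) (X * Bc + mat_adjoint Bc * X) \<and>
           (\<exists>z \<in> carrier_vec d. z \<noteq> 0\<^sub>v d \<and>
              ((X * Bc + mat_adjoint Bc * X + complex_of_real (2 * \<mu>) \<cdot>\<^sub>m X) *\<^sub>v z) \<bullet>c z = 0)"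
      using X by blast
  next
    fix \<epsilon> :: real assume "\<epsilon> > 0"
    then have "\<forall>(n, k) \<in> set xs. Re k \<le> \<mu> + \<epsilon> \<and> (n > 1 \<longrightarrow> Re k < \<mu> + \<epsilon>)"
      using le by fastforce
    from lyapunov_inequality[OF assms(2) xs this]
    show "\<exists>X \<in> carrier_mat d d. pos_def_mat X \<and>
           loewner_le (complex_of_real (- 2 * (\<mu> + \<epsilon>)) \<cdot>\<^sub>m X) (X * Bc + mat_adjoint Bc * X)"
      .
  qed
qed

end
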